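(* Let $A_1,\ldots,A_r$ be non-zero positive semidefinite operators on a finite-dimensional Hilbert space, and let $p_k:=\operatorname{Tr}A_k$, $\sigma_k:=A_k/\operatorname{Tr}A_k$. Then $$P_e^*(A_1,\ldots,A_r)\le\sum_{(i,j):\,i\ne j}\operatorname{Tr}A_i^{1/2}A_j^{1/2}\le\sum_{(i,j):\,i\ne j}F(A_i,A_j),$$ and $\sum_{(i,j):\,i\ne j}F(A_i,A_j)$ is bounded above by each of the two quantities $$\sum_{(i,j):\,i\ne j}\sqrt{p_i+p_j}\;P_e^*(A_i,A_j)^{1/2}\qquad\text{and}\qquad\sum_{(i,j):\,i\ne j}\sqrt{p_ip_j}\;Q_{\min}(\sigma_i,\sigma_j)^{1/2}.$$ In the special case that all states $\sigma_k$ are pure (i.e. of rank one), we have $$P_e^*(A_1,\ldots,A_r)\le\sum_{(i,j):\,i\ne j}\operatorname{Tr}A_i^{1/2}A_j^{1/2}=\sum_{(i,j):\,i\ne j}\sqrt{p_ip_j}\;Q_{\min}(\sigma_i,\sigma_j)$$ $$=\sum_{(i,j):\,i\ne j}\frac1{\sqrt{p_ip_j}}F(A_i,A_j)^2\le\sum_{(i,j):\,i\ne j}\frac{p_i+p_j}{\sqrt{p_ip_j}}P_e^*(A_i,A_j).$$ Sums run over ordered pairs $(i,j)$ with $i\neq j$.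
   Context: A POVM $\{E_1,\ldots,E_m\}$ on a finite-dimensional Hilbert space is a family of positive semidefinite operators with $E_1+\cdots+E_m\le I$. For positive semidefinite $A_1,\ldots,A_m$, the optimal error is $P_e^*(A_1,\ldots,A_m):=\min\{\sum_{i=1}^m\operatorname{Tr}A_i(I-E_i):\{E_1,\ldots,E_m\}\text{ POVM}\}$; for two operators this equals $\frac12\operatorname{Tr}(A+B)-\frac12\|A-B\|_1$ with the trace norm. The fidelity is $F(A,B):=\|A^{1/2}B^{1/2}\|_1$, and $Q_{\min}(A,B):=\min_{0\le s\le1}\operatorname{Tr}A^sB^{1-s}$, where powers of a positive semidefinite operator are taken only on its support (so $A^0$ is the projection onto the support of $A$). *)

theory Defs
  imports "HOL-Analysis.Analysis"
begin

text \<open>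
  Operators on a finite-dimensional Hilbert space are represented, in an orthonormal basis,
  by square complex matrices; the dimension is the cardinality of the index type.
\<close>

type_synonym 'n cmat = "complex^'n^'n"

definition cinner :: "complex^'n \<Rightarrow> complex^'n \<Rightarrow> complex" where
  "cinner x y = (\<Sum>i\<in>UNIV. cnj (x $ i) * y $ i)"

definition adj :: "'n::finite cmat \<Rightarrow> 'n cmat" where
  "adj A = (\<chi> i j. cnj (A $ j $ i))"

definition psd :: "'n::finite cmat \<Rightarrow> bool" where
  "psd A \<longleftrightarrow> (\<forall>x. cinner x (A *v x) \<in> \<real> \<and> 0 \<le> Re (cinner x (A *v x)))"

text \<open>
  The real part only serves to obtain a real number: below, \<open>tr\<close> is applied to positive
  semidefinite operators and to products of two of them, whose traces are real.
\<close>

definition tr :: "'n::finite cmat \<Rightarrow> real" where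
  "tr A = Re (trace A)"

definition unitary :: "'n::finite cmat \<Rightarrow> bool" where
  "unitary U \<longleftrightarrow> adj U ** U = mat 1 \<and> U ** adj U = mat 1"

definition diagmat :: "('n::finite \<Rightarrow> real) \<Rightarrow> 'n cmat" where
  "diagmat d = (\<chi> i j. if i = j then complex_of_real (d i) else 0)"

text \<open>
  Powers by functional calculus. Since \<open>0 powr s = 0\<close> for every \<open>s\<close>, including \<open>s = 0\<close>,
  powers are taken on the support only; in particular \<open>mpow A 0\<close> is the projection onto the
  support of a positive semidefinite \<open>A\<close>. By \<open>mpow_eq\<close> below the value does not depend on
  the diagonalization.
\<close>

definition mpow :: "'n::finite cmat \<Rightarrow> real \<Rightarrow> 'n cmat" where
  "mpow A s = (THE B. \<exists>U d. unitary U \<and> A = U ** diagmat d ** adj U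
                          \<and> B = U ** diagmat (\<lambda>i. d i powr s) ** adj U)"

lemma diagmat_mult_left: "(diagmat d ** M) $ i $ j = complex_of_real (d i) * M $ i $ j"
  by (simp add: matrix_matrix_mult_def diagmat_def if_distrib[of "\<lambda>x. _ * x"]
      if_distrib[of "\<lambda>x. x * _"] cong: if_cong)

lemma diagmat_mult_right: "(M ** diagmat d) $ i $ j = M $ i $ j * complex_of_real (d j)"
  by (simp add: matrix_matrix_mult_def diagmat_def if_distrib[of "\<lambda>x. _ * x"]
      if_distrib[of "\<lambda>x. x * _"] cong: if_cong)

lemma unitary_diag_unique:
  assumes U: "unitary U" and V: "unitary V"
    and eq: "U ** diagmat d ** adj U = V ** diagmat e ** adj V"
  shows "U ** diagmat (\<lambda>i. d i powr s) ** adj U = V ** diagmat (\<lambda>i. e i powr s) ** adj V"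
proof -
  define W where "W = adj V ** U"
  have conj: "W ** diagmat f = diagmat g ** W \<longleftrightarrow>
      U ** diagmat f ** adj U = V ** diagmat g ** adj V" for f g
  proof
    assume "W ** diagmat f = diagmat g ** W"
    then have "V ** (W ** diagmat f) ** adj U = V ** (diagmat g ** W) ** adj U" by simp
    moreover have "V ** (W ** diagmat f) ** adj U = (V ** adj V) ** (U ** diagmat f ** adj U)"
      by (simp add: W_def matrix_mul_assoc)
    moreover have "V ** (diagmat g ** W) ** adj U = (V ** diagmat g ** adj V) ** (U ** adj U)"
      by (simp add: W_def matrix_mul_assoc)
    ultimately show "U ** diagmat f ** adj U = V ** diagmat g ** adj V"
      using U V by (simp add: unitary_def)
  next
    assume "U ** diagmat f ** adj U = V ** diagmat g ** adj V"
    then have "adj V ** (U ** diagmat f ** adj U) ** U = adj V ** (V ** diagmat g ** adj V) ** U"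
      by simp
    moreover have "adj V ** (U ** diagmat f ** adj U) ** U = W ** diagmat f ** (adj U ** U)"
      by (simp add: W_def matrix_mul_assoc)
    moreover have "adj V ** (V ** diagmat g ** adj V) ** U = (adj V ** V) ** (diagmat g ** W)"
      by (simp add: W_def matrix_mul_assoc)
    ultimately show "W ** diagmat f = diagmat g ** W"
      using U V by (simp add: unitary_def)
  qed
  have *: "W ** diagmat d = diagmat e ** W" using conj eq by blast
  have "W $ i $ j * complex_of_real (d j) = complex_of_real (e i) * W $ i $ j" for i j
    using arg_cong[OF *, of "\<lambda>M. M $ i $ j"]
    by (simp add: diagmat_mult_left diagmat_mult_right)
  then have "W $ i $ j = 0 \<or> d j = e i" for i j
    by (metis mult.commute mult_cancel_left of_real_eq_iff)
  then have "W ** diagmat (\<lambda>i. d i powr s) = diagmat (\<lambda>i. e i powr s) ** W"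
    by (auto simp: vec_eq_iff diagmat_mult_left diagmat_mult_right) (metis mult.commute mult_zero_left)
  then show ?thesis using conj by blast
qed

lemma mpow_eq:
  assumes "unitary U" and "A = U ** diagmat d ** adj U"
  shows "mpow A s = U ** diagmat (\<lambda>i. d i powr s) ** adj U"
  unfolding mpow_def
proof (rule the_equality)
  show "\<exists>V e. unitary V \<and> A = V ** diagmat e ** adj V \<and>
      U ** diagmat (\<lambda>i. d i powr s) ** adj U = V ** diagmat (\<lambda>i. e i powr s) ** adj V"
    using assms by blast
next
  fix B
  assume "\<exists>V e. unitary V \<and> A = V ** diagmat e ** adj V \<and>
      B = V ** diagmat (\<lambda>i. e i powr s) ** adj V"
  then show "B = U ** diagmat (\<lambda>i. d i powr s) ** adj U"
    using assms unitary_diag_unique by metis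
qed

definition trace_norm :: "'n::finite cmat \<Rightarrow> real" where
  "trace_norm X = tr (mpow (adj X ** X) (1/2))"

definition fidelity :: "'n::finite cmat \<Rightarrow> 'n cmat \<Rightarrow> real" where
  "fidelity A B = trace_norm (mpow A (1/2) ** mpow B (1/2))"

text \<open>
  The infima in \<open>Q_min\<close> and \<open>opt_err\<close> are minima for positive semidefinite arguments (and a
  finite index set), by continuity and compactness.
\<close>

definition Q_min :: "'n::finite cmat \<Rightarrow> 'n cmat \<Rightarrow> real" where
  "Q_min A B = (INF s\<in>{0..1}. tr (mpow A s ** mpow B (1 - s)))"

definition povm :: "'k set \<Rightarrow> ('k \<Rightarrow> 'n::finite cmat) \<Rightarrow> bool" where
  "povm I E \<longleftrightarrow> (\<forall>i\<in>I. psd (E i)) \<and> psd (mat 1 - (\<Sum>i\<in>I. E i))"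

text \<open>
  Optimal error of a family indexed by a finite set \<open>I\<close>. For \<open>i \<noteq> j\<close>, the two-operator
  quantity for \<open>A i\<close> and \<open>A j\<close> is \<open>opt_err {i, j} A\<close>.
\<close>

definition opt_err :: "'k set \<Rightarrow> ('k \<Rightarrow> 'n::finite cmat) \<Rightarrow> real" where
  "opt_err I A = (INF E\<in>{E. povm I E}. \<Sum>i\<in>I. tr (A i ** (mat 1 - E i)))"

definition ordered_pairs :: "'k set \<Rightarrow> ('k \<times> 'k) set" where
  "ordered_pairs I = {(i, j). i \<in> I \<and> j \<in> I \<and> i \<noteq> j}"

end

theory Submission
  imports Defs
begin

text \<open>
  The multi-hypothesis bound is attained by the pretty good measurement of the square roots,
  \<open>E\<^sub>i = K\<^sup>-\<^sup>1\<^sup>/\<^sup>2 B\<^sub>i K\<^sup>-\<^sup>1\<^sup>/\<^sup>2\<close> with \<open>B\<^sub>i = A\<^sub>i\<^sup>1\<^sup>/\<^sup>2\<close> and \<open>K = \<Sum>B\<^sub>j\<close>: already for each single \<open>i\<close> one has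
  \<open>Tr A\<^sub>i (I - E\<^sub>i) \<le> Tr B\<^sub>i K - Tr A\<^sub>i = \<Sum>\<^sub>j\<^sub>\<noteq>\<^sub>i Tr B\<^sub>i B\<^sub>j\<close>.
  The bounds on the fidelity write \<open>\<parallel>X\<parallel>\<^sub>1 = Tr W\<^sup>* X\<close> with a partial isometry \<open>W\<close>,
  split \<open>X = A\<^sup>1\<^sup>/\<^sup>2 B\<^sup>1\<^sup>/\<^sup>2\<close> in two ways (inserting \<open>I = E + (I - E)\<close> for a test \<open>E\<close>, or
  splitting the exponents as \<open>1/2 = s/2 + (1-s)/2\<close>) and apply the Cauchy-Schwarz inequality of the
  Hilbert-Schmidt inner product. If \<open>\<sigma>\<close> is pure then \<open>\<sigma>\<^sup>s = \<sigma>\<close> for all \<open>s\<close> and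
  \<open>\<sigma> M \<sigma> = (Tr M \<sigma>) \<sigma>\<close>, which makes all quantities explicit.
\<close>

subsection \<open>The spectral theorem\<close>

text \<open>The quadratic form \<open>x \<bullet> f x\<close> attains a maximum \<open>m\<close> on
  the compact unit sphere of \<open>W\<close>, and the first variation at a maximizer forces it to
  be an eigenvector.\<close>

lemma selfadjoint_eigenvector_on_subspace:
  fixes f :: "'a::euclidean_space \<Rightarrow> 'a"
  assumes lin: "linear f" and W: "subspace W" and inv: "\<And>x. x \<in> W \<Longrightarrow> f x \<in> W"
    and sym: "\<And>x y. x \<bullet> f y = f x \<bullet> y" and w: "w \<in> W" "w \<noteq> 0"
  obtains x m where "x \<in> W" "norm x = 1" "f x = m *\<^sub>R x"
proof -
  let ?S = "W \<inter> sphere 0 1"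
  have "compact ?S"
    by (simp add: W closed_Int_compact closed_subspace)
  moreover have "w /\<^sub>R norm w \<in> ?S"
    using w W by (auto simp: subspace_scale)
  then have "?S \<noteq> {}" by blast
  moreover have "continuous_on ?S (\<lambda>x. x \<bullet> f x)"
    using lin by (intro continuous_intros linear_continuous_on linear_conv_bounded_linear[THEN iffD1])
  ultimately obtain x where x: "x \<in> ?S" and mx: "\<And>y. y \<in> ?S \<Longrightarrow> y \<bullet> f y \<le> x \<bullet> f x"
    using continuous_attains_sup by metis
  define m where "m = x \<bullet> f x"
  have le: "y \<bullet> f y \<le> m * (y \<bullet> y)" if "y \<in> W" for y
  proof (cases "y = 0")
    case False
    have "y /\<^sub>R norm y \<in> ?S" using that W False by (auto simp: subspace_scale)
    from mx[OF this] have "(y \<bullet> f y) / (norm y)\<^sup>2 \<le> m"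
      by (simp add: linear_scale[OF lin] m_def divide_inverse power2_eq_square mult_ac)
    then show ?thesis using False by (simp add: divide_le_eq dot_square_norm)
  qed (simp add: linear_0[OF lin])
  \<comment> \<open>The residual of the eigenvector equation. It lies in \<open>W\<close>, so moving
    \<open>x\<close> along it stays inside the domain of the maximization.\<close>
  define y where "y = m *\<^sub>R x - f x"
  have yW: "y \<in> W" unfolding y_def using x W inv by (simp add: subspace_diff subspace_scale)
  define N H where "N = y \<bullet> y" and "H = m * (y \<bullet> y) - y \<bullet> f y"
  have H: "0 \<le> H" using le[OF yW] by (simp add: H_def)
  have xx: "x \<bullet> x = 1" using x by (simp add: dot_square_norm)
  have N: "N = m * (x \<bullet> y) - y \<bullet> f x"
    by (simp add: N_def y_def inner_diff inner_commute algebra_simps)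
  \<comment> \<open>This is \<open>le\<close> at \<open>x + t *\<^sub>R y\<close>; the terms of
    order zero in \<open>t\<close> cancel.\<close>
  have quad: "0 \<le> 2 * t * N + t\<^sup>2 * H" for t
  proof -
    have "x + t *\<^sub>R y \<in> W" using x yW W by (simp add: subspace_add subspace_scale)
    from le[OF this] have "m + t * (x \<bullet> f y) + t * (y \<bullet> f x) + t * t * (y \<bullet> f y)
        \<le> m * (1 + 2 * t * (x \<bullet> y) + t * t * (y \<bullet> y))"
      by (simp add: linear_add[OF lin] linear_scale[OF lin] inner_add inner_commute xx
          m_def[symmetric] algebra_simps)
    moreover have "x \<bullet> f y = y \<bullet> f x" using sym by (simp add: inner_commute)
    ultimately show ?thesis by (simp add: N H_def power2_eq_square algebra_simps)
  qed
  have "N = 0"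
  proof (rule ccontr)
    assume "N \<noteq> 0"
    \<comment> \<open>At \<open>t = - u\<close> the quadratic takes the value
      \<open>- (u\<^sup>2 * (H + 2))\<close>. The denominator \<open>H + 1\<close> is positive even
      if \<open>H = 0\<close>.\<close>
    define u where "u = N / (H + 1)"
    have u: "N = u * (H + 1)" using H by (simp add: u_def)
    have "0 \<le> - (u\<^sup>2 * (H + 2))"
      using quad[of "- u"] by (simp add: u power2_eq_square algebra_simps)
    moreover have "0 < u\<^sup>2 * (H + 2)" using H \<open>N \<noteq> 0\<close> u by auto
    ultimately show False by linarith
  qed
  then have "f x = m *\<^sub>R x" by (simp add: N_def y_def)
  with x show ?thesis by (intro that[of x m]) simp_all
qed

section \<open>The complex inner product and the adjoint\<close>

lemma cinner_add_right: "cinner x (y + z) = cinner x y + cinner x z"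
  and cinner_add_left: "cinner (x + y) z = cinner x z + cinner y z"
  and cinner_diff_right: "cinner x (y - z) = cinner x y - cinner x z"
  and cinner_smult_right: "cinner x (c *s y) = c * cinner x y"
  and cinner_smult_left: "cinner (c *s x) y = cnj c * cinner x y"
  and cinner_scaleR_right: "cinner x (r *\<^sub>R y) = complex_of_real r * cinner x y"
  and cinner_commute: "cinner x y = cnj (cinner y x)"
  by (simp_all add: cinner_def sum.distrib sum_subtractf sum_distrib_left algebra_simps
      scaleR_conv_of_real[where 'a = complex])

lemma cinner_zero_right [simp]: "cinner x 0 = 0"
  by (simp add: cinner_def)

lemma cinner_sum_right: "cinner x (\<Sum>i\<in>I. g i) = (\<Sum>i\<in>I. cinner x (g i))"
  by (induction I rule: infinite_finite_induct) (auto simp: cinner_add_right)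

lemma inner_eq_Re_cinner: "x \<bullet> y = Re (cinner x y)"
  by (simp add: cinner_def inner_vec_def inner_complex_def)

lemma cinner_self: "cinner x x = complex_of_real ((norm x)\<^sup>2)"
proof -
  have "Im (cinner x x) = 0" by (simp add: cinner_def)
  then show ?thesis
    by (simp add: complex_eq_iff inner_eq_Re_cinner[symmetric] dot_square_norm)
qed

lemma adj_component [simp]: "adj M $ i $ j = cnj (M $ j $ i)"
  by (simp add: adj_def)

lemma adj_adj [simp]: "adj (adj M) = M"
  by (simp add: vec_eq_iff)

lemma adj_mult: "adj (M ** N) = adj N ** adj M"
  by (simp add: vec_eq_iff matrix_matrix_mult_def mult.commute)

lemma adj_mat_1 [simp]: "adj (mat 1) = mat 1"
  by (simp add: vec_eq_iff mat_def)

lemma adj_diagmat [simp]: "adj (diagmat d) = diagmat d"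
  by (simp add: vec_eq_iff diagmat_def)

lemma adj_diff: "adj (M - N) = adj M - adj N"
  by (simp add: vec_eq_iff)

lemma cinner_matrix_left: "cinner (M *v x) y = cinner x (adj M *v y)"
proof -
  have "cinner (M *v x) y = (\<Sum>i\<in>UNIV. \<Sum>j\<in>UNIV. cnj (M $ i $ j) * cnj (x $ j) * y $ i)"
    by (simp add: cinner_def matrix_vector_mult_def sum_distrib_right)
  also have "\<dots> = (\<Sum>j\<in>UNIV. \<Sum>i\<in>UNIV. cnj (M $ i $ j) * cnj (x $ j) * y $ i)"
    by (rule sum.swap)
  also have "\<dots> = cinner x (adj M *v y)"
    by (simp add: cinner_def matrix_vector_mult_def sum_distrib_left algebra_simps)
  finally show ?thesis .
qed

lemma cinner_ext: "(\<And>x. cinner x y = cinner x z) \<Longrightarrow> y = z"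
  using cinner_self[of "y - z"] by (simp add: cinner_diff_right)

text \<open>Polarization: reality of the quadratic form at \<open>x + y\<close> and at
  \<open>x + \<i> *s y\<close> compares the imaginary and the real parts of
  \<open>cinner x (A *v y)\<close> and \<open>cinner y (A *v x)\<close>.\<close>

lemma psd_hermitian:
  assumes "psd A"
  shows "adj A = A"
proof -
  have real: "Im (cinner x (A *v x)) = 0" for x
    using assms by (auto simp: psd_def complex_is_Real_iff)
  have "cinner x (adj A *v y) = cinner x (A *v y)" for x y
  proof -
    have "Im (cinner x (A *v y) + cinner y (A *v x)) = 0"
      using real[of "x + y"] real[of x] real[of y]
      by (simp add: cinner_add_right cinner_add_left matrix_vector_right_distrib)
    moreover have "Re (cinner x (A *v y)) = Re (cinner y (A *v x))"
      using real[of "x + \<i> *s y"] real[of x] real[of y]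
      by (simp add: cinner_add_right cinner_add_left matrix_vector_right_distrib
          vector_scalar_commute cinner_smult_right cinner_smult_left)
    moreover have "cinner x (adj A *v y) = cnj (cinner y (A *v x))"
      by (metis cinner_matrix_left cinner_commute)
    ultimately show ?thesis by (simp add: complex_eq_iff)
  qed
  then have "adj A *v y = A *v y" for y by (intro cinner_ext)
  then show ?thesis by (simp add: matrix_eq)
qed

text \<open>Induction over \<open>J\<close>: the orthogonal complement \<open>W\<close> of the
  eigenvectors found so far is invariant and nonzero. The eigenvector comes from the underlying real
  Euclidean space, whose inner product is the real part of \<open>cinner\<close>; this also makes
  the eigenvalues real.\<close>

lemma hermitian_orthonormal_eigenvectors:
  fixes A :: "'n::finite cmat" and J :: "'n set"
  assumes A: "adj A = A"
  shows "\<exists>f d. \<forall>i\<in>J. A *v f i = (d i :: real) *\<^sub>R f i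
    \<and> (\<forall>j\<in>J. cinner (f i) (f j) = (if i = j then 1 else 0))"
  using finite[of J]
proof (induction J rule: finite_induct)
  case (insert k J)
  then obtain f d where ev: "\<And>i. i \<in> J \<Longrightarrow> A *v f i = (d i :: real) *\<^sub>R f i"
    and on: "\<And>i j. i \<in> J \<Longrightarrow> j \<in> J \<Longrightarrow> cinner (f i) (f j) = (if i = j then 1 else 0)"
    by blast
  define W where "W = {x. \<forall>i\<in>J. cinner (f i) x = 0}"
  have "vec.dim (f ` J) < CARD('n)"
  proof -
    have "vec.dim (f ` J) \<le> card (f ` J)" by (simp add: vec.dim_le_card')
    also have "\<dots> \<le> card J" by (simp add: card_image_le)
    also have "\<dots> < card (insert k J)" using insert by simp
    also have "\<dots> \<le> CARD('n)" by (rule card_mono) auto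
    finally show ?thesis .
  qed
  then have "vec.span (f ` J) \<noteq> UNIV"
    by (metis nat_neq_iff vec.dim_span vec_dim_card)
  then obtain y where y: "y \<notin> vec.span (f ` J)" by blast
  \<comment> \<open>A Gram-Schmidt step: removing from \<open>y\<close> its projection to the span
    leaves a nonzero vector of \<open>W\<close>.\<close>
  define z where "z = y - (\<Sum>i\<in>J. cinner (f i) y *s f i)"
  have "(\<Sum>i\<in>J. cinner (f i) y *s f i) \<in> vec.span (f ` J)"
    by (intro vec.span_sum vec.span_scale vec.span_base) auto
  then have "z \<noteq> 0" using y by (auto simp: z_def)
  have "z \<in> W"
    by (auto simp: W_def z_def cinner_diff_right cinner_sum_right cinner_smult_right on
        if_distrib[of "\<lambda>x. _ * x"] insert.hyps(1) cong: if_cong sum.cong)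
  have sub: "subspace W"
    by (auto simp: subspace_def W_def cinner_add_right cinner_scaleR_right)
  have inv: "A *v x \<in> W" if "x \<in> W" for x
  proof -
    have "cinner (f i) (A *v x) = 0" if i: "i \<in> J" for i
    proof -
      have "cinner (f i) (A *v x) = cinner (A *v f i) x" using A by (metis cinner_matrix_left)
      also have "\<dots> = cnj (cinner x (d i *\<^sub>R f i))" using ev[OF i] by (metis cinner_commute)
      also have "\<dots> = complex_of_real (d i) * cinner (f i) x"
        using cinner_commute[of "f i" x] by (simp add: cinner_scaleR_right)
      finally show ?thesis using \<open>x \<in> W\<close> i by (simp add: W_def)
    qed
    then show ?thesis by (simp add: W_def)
  qed
  have sym: "x \<bullet> (A *v y) = (A *v x) \<bullet> y" for x y
    using A by (metis cinner_matrix_left inner_eq_Re_cinner)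
  obtain x m where x: "x \<in> W" "norm x = 1" "A *v x = m *\<^sub>R x"
    using selfadjoint_eigenvector_on_subspace[OF matrix_vector_mul_linear sub inv sym \<open>z \<in> W\<close> \<open>z \<noteq> 0\<close>]
    by blast
  have x1: "cinner x x = 1" using x by (simp add: cinner_self)
  have x0: "cinner (f i) x = 0" "cinner x (f i) = 0" if "i \<in> J" for i
    using x that by (auto simp: W_def) (metis cinner_commute complex_cnj_zero)
  show ?case
    apply (rule exI[of _ "f(k := x)"], rule exI[of _ "d(k := m)"])
    using insert.hyps x x1 x0 ev on by auto
qed simp

text \<open>With \<open>J = UNIV\<close> there are as many orthonormal eigenvectors as coordinates,
  so they form the columns of a unitary \<open>U\<close>.\<close>

lemma psd_diagonalization:
  fixes A :: "'n::finite cmat"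
  assumes "psd A"
  obtains U d where "unitary U" "A = U ** diagmat d ** adj U" "\<And>i. 0 \<le> d i"
proof -
  obtain f :: "'n \<Rightarrow> complex^'n" and d where fd: "\<forall>i\<in>UNIV. A *v f i = (d i :: real) *\<^sub>R f i
      \<and> (\<forall>j\<in>UNIV. cinner (f i) (f j) = (if i = j then 1 else 0))"
    using hermitian_orthonormal_eigenvectors[OF psd_hermitian[OF assms]] by blast
  have ev: "A *v f i = d i *\<^sub>R f i" for i using fd by simp
  have on: "cinner (f i) (f j) = (if i = j then 1 else 0)" for i j using fd by simp
  define U where "U = (\<chi> i j. f j $ i)"
  have 1: "adj U ** U = mat 1"
    using on by (simp add: vec_eq_iff matrix_matrix_mult_def U_def mat_def cinner_def)
  then have 2: "U ** adj U = mat 1" using matrix_left_right_inverse by blast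
  have "A ** U = U ** diagmat d"
  proof -
    have "(A ** U) $ i $ j = (U ** diagmat d) $ i $ j" for i j
    proof -
      have "(A ** U) $ i $ j = (A *v f j) $ i"
        by (simp add: U_def matrix_matrix_mult_def matrix_vector_mult_def)
      also have "\<dots> = d j *\<^sub>R f j $ i" by (simp add: ev)
      also have "\<dots> = (U ** diagmat d) $ i $ j"
        by (simp add: diagmat_mult_right U_def scaleR_conv_of_real mult.commute)
      finally show ?thesis .
    qed
    then show ?thesis by (simp add: vec_eq_iff)
  qed
  then have "A = U ** diagmat d ** adj U"
    using 2 by (metis matrix_mul_assoc matrix_mul_rid)
  moreover have "0 \<le> d i" for i
  proof -
    have "0 \<le> Re (cinner (f i) (A *v f i))" using assms by (simp add: psd_def)
    then show ?thesis by (simp add: ev cinner_scaleR_right on)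
  qed
  ultimately show ?thesis using 1 2 that by (auto simp: unitary_def)
qed

subsection \<open>Traces and powers\<close>

lemma matrix_diff_ldistrib: "(M :: 'a::ring_1^'n^'m) ** (N - P) = M ** N - M ** P"
  and matrix_diff_rdistrib: "(N - P) ** (Q :: 'a::ring_1^'k^'n) = N ** Q - P ** Q"
  by (simp_all add: vec_eq_iff matrix_matrix_mult_def sum_subtractf algebra_simps)

lemma matrix_add_rdistrib: "(N + P) ** (Q :: 'a::semiring_1^'k^'n) = N ** Q + P ** Q"
  by (simp add: vec_eq_iff matrix_matrix_mult_def sum.distrib distrib_right)

lemma matrix_sum_ldistrib: "(M :: 'a::ring_1^'n^'m) ** (\<Sum>i\<in>I. g i) = (\<Sum>i\<in>I. M ** g i)"
  and matrix_sum_rdistrib: "(\<Sum>i\<in>I. h i) ** (Q :: 'a::ring_1^'k^'n) = (\<Sum>i\<in>I. h i ** Q)"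
  by (induction I rule: infinite_finite_induct)
    (simp_all add: matrix_add_ldistrib matrix_add_rdistrib)

lemma matrix_scaleR_left: "(r *\<^sub>R M) ** (N :: 'a::real_algebra_1^'k^'n) = r *\<^sub>R (M ** N)"
  and matrix_scaleR_right: "M ** (r *\<^sub>R (N :: 'a::real_algebra_1^'k^'n)) = r *\<^sub>R (M ** N)"
  by (simp_all add: vec_eq_iff matrix_matrix_mult_def scaleR_sum_right)

lemma tr_add: "tr (M + N) = tr M + tr N"
  and tr_diff: "tr (M - N) = tr M - tr N"
  and tr_scaleR: "tr (r *\<^sub>R M) = r * tr M"
  by (simp_all add: tr_def trace_def sum.distrib sum_subtractf sum_distrib_left)

lemma tr_zero [simp]: "tr 0 = 0"
  by (simp add: tr_def trace_def)

lemma tr_sum: "tr (\<Sum>i\<in>I. g i) = (\<Sum>i\<in>I. tr (g i))"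
  by (induction I rule: infinite_finite_induct) (simp_all add: tr_add)

lemma tr_mult_commute: "tr (M ** N) = tr (N ** M)"
  unfolding tr_def by (rule arg_cong[OF trace_mul_sym])

text \<open>The Euclidean inner product of the matrix type is the real part of the Hilbert-Schmidt
  product. Cauchy-Schwarz for matrices thus becomes the one of Euclidean spaces.\<close>

lemma inner_eq_tr: "M \<bullet> N = tr (adj M ** N)"
proof -
  have "tr (adj M ** N) = (\<Sum>i\<in>UNIV. \<Sum>j\<in>UNIV. M $ j $ i \<bullet> N $ j $ i)"
    by (simp add: tr_def trace_def matrix_matrix_mult_def inner_complex_def)
  also have "\<dots> = M \<bullet> N"
    unfolding inner_vec_def by (rule sum.swap)
  finally show ?thesis ..
qed

section \<open>Positive semidefinite matrices\<close>

lemma psd_gram: "psd (adj X ** X)"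
proof -
  have "cinner x ((adj X ** X) *v x) = complex_of_real ((norm (X *v x))\<^sup>2)" for x
    using cinner_self[of "X *v x"] by (simp add: cinner_matrix_left matrix_vector_mul_assoc)
  then show ?thesis unfolding psd_def by simp
qed

lemma psd_congruence:
  assumes "psd A"
  shows "psd (adj X ** A ** X)"
proof -
  have "cinner x ((adj X ** A ** X) *v x) = cinner (X *v x) (A *v (X *v x))" for x
    by (simp add: cinner_matrix_left matrix_vector_mul_assoc matrix_mul_assoc)
  then show ?thesis using assms by (simp only: psd_def) blast
qed

lemma psd_zero [simp]: "psd 0"
  by (simp add: psd_def)

lemma psd_mat_1 [simp]: "psd (mat 1)"
  using psd_gram[of "mat 1"] by simp

lemma psd_add: "psd A \<Longrightarrow> psd B \<Longrightarrow> psd (A + B)"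
  by (auto simp: psd_def cinner_add_right matrix_vector_mult_add_rdistrib)

lemma psd_sum: "(\<And>i. i \<in> I \<Longrightarrow> psd (g i)) \<Longrightarrow> psd (\<Sum>i\<in>I. g i)"
  by (induction I rule: infinite_finite_induct) (auto simp: psd_add)

lemma psd_scaleR: "psd A \<Longrightarrow> 0 \<le> r \<Longrightarrow> psd (r *\<^sub>R A)"
proof -
  assume "psd A" "0 \<le> r"
  moreover have "cinner x ((r *\<^sub>R A) *v x) = complex_of_real r * cinner x (A *v x)" for x
  proof -
    have "(r *\<^sub>R A) *v x = r *\<^sub>R (A *v x)"
      by (simp add: vec_eq_iff matrix_vector_mult_def scaleR_sum_right)
    then show ?thesis by (simp add: cinner_scaleR_right)
  qed
  ultimately show "psd (r *\<^sub>R A)" by (simp add: psd_def)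
qed

lemma psd_projection:
  assumes "adj P = P" "P ** P = P"
  shows "psd P" "psd (mat 1 - P)"
proof -
  show "psd P" using psd_gram[of P] assms by simp
  have "adj (mat 1 - P) ** (mat 1 - P) = mat 1 - P"
    using assms by (simp add: adj_diff matrix_diff_ldistrib matrix_diff_rdistrib)
  then show "psd (mat 1 - P)" using psd_gram[of "mat 1 - P"] by simp
qed

lemma diagmat_mult: "diagmat d ** diagmat e = diagmat (\<lambda>i. d i * e i)"
  by (simp add: vec_eq_iff diagmat_mult_left) (simp add: diagmat_def)

lemma diagmat_1 [simp]: "diagmat (\<lambda>i. 1) = mat 1"
  by (simp add: vec_eq_iff diagmat_def mat_def)

section \<open>Powers of a positive semidefinite matrix\<close>

context
  fixes A :: "'n::finite cmat"
  assumes A: "psd A"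
begin

lemma mpow_hermitian: "adj (mpow A s) = mpow A s"
proof -
  obtain U d where "unitary U" "A = U ** diagmat d ** adj U"
    using psd_diagonalization[OF A] by metis
  from mpow_eq[OF this] show ?thesis by (simp add: adj_mult matrix_mul_assoc)
qed

text \<open>All real exponents are allowed because \<open>0 powr s = 0\<close>. In particular
  \<open>mpow A (- s)\<close> is a pseudo-inverse of \<open>mpow A s\<close>: their product is the
  support projection \<open>mpow A 0\<close>.\<close>

lemma mpow_mult: "mpow A s ** mpow A t = mpow A (s + t)"
proof -
  obtain U d where U: "unitary U" "A = U ** diagmat d ** adj U"
    using psd_diagonalization[OF A] by metis
  have "mpow A s ** mpow A t
      = U ** diagmat (\<lambda>i. d i powr s) ** (adj U ** U) ** diagmat (\<lambda>i. d i powr t) ** adj U"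
    by (simp add: mpow_eq[OF U] matrix_mul_assoc)
  also have "\<dots> = U ** (diagmat (\<lambda>i. d i powr s) ** diagmat (\<lambda>i. d i powr t)) ** adj U"
    using U by (simp add: unitary_def matrix_mul_assoc)
  finally show ?thesis by (simp add: mpow_eq[OF U] diagmat_mult powr_add)
qed

lemma mpow_1 [simp]: "mpow A 1 = A"
proof -
  obtain U d where U: "unitary U" "A = U ** diagmat d ** adj U" "\<And>i. 0 \<le> d i"
    using psd_diagonalization[OF A] by metis
  have "mpow A 1 = U ** diagmat d ** adj U"
    unfolding mpow_eq[OF U(1,2)] using U(3) by simp
  then show ?thesis by (simp only: U(2)[symmetric])
qed

lemma psd_mpow: "psd (mpow A s)"
  using psd_gram[of "mpow A (s/2)"] by (simp add: mpow_hermitian mpow_mult)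

lemma tr_psd_nonneg: "0 \<le> tr A"
  using inner_eq_tr[of "mpow A (1/2)" "mpow A (1/2)"]
  by (simp add: mpow_hermitian mpow_mult) (metis inner_ge_zero)

lemma mpow_scaleR:
  assumes "0 \<le> r"
  shows "mpow (r *\<^sub>R A) s = r powr s *\<^sub>R mpow A s"
proof -
  obtain U d where U: "unitary U" "A = U ** diagmat d ** adj U" "\<And>i. 0 \<le> d i"
    using psd_diagonalization[OF A] by metis
  have sc: "r *\<^sub>R (U ** diagmat e ** adj U) = U ** diagmat (\<lambda>i. r * e i) ** adj U" for r e
  proof -
    have "diagmat (\<lambda>i. r * e i) = r *\<^sub>R diagmat e"
      by (simp add: vec_eq_iff diagmat_def scaleR_conv_of_real[where 'a = complex])
    then show ?thesis by (simp add: matrix_scaleR_left matrix_scaleR_right)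
  qed
  have "r *\<^sub>R A = U ** diagmat (\<lambda>i. r * d i) ** adj U"
    unfolding U(2) by (rule sc)
  then have "mpow (r *\<^sub>R A) s = U ** diagmat (\<lambda>i. r powr s * d i powr s) ** adj U"
    using mpow_eq[OF U(1)] assms U(3) by (simp add: powr_mult)
  also have "\<dots> = r powr s *\<^sub>R mpow A s"
    unfolding mpow_eq[OF U(1,2)] by (rule sc[symmetric])
  finally show ?thesis .
qed

end

text \<open>By cyclicity this is the trace of the congruence
  \<open>mpow B (1/2) ** A ** mpow B (1/2)\<close>.\<close>

lemma tr_mult_nonneg:
  assumes "psd A" "psd B"
  shows "0 \<le> tr (A ** B)"
proof -
  have "tr (A ** B) = tr (A ** mpow B (1/2) ** mpow B (1/2))"
    using mpow_mult[OF assms(2), of "1/2" "1/2"] mpow_1[OF assms(2)]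
    by (simp flip: matrix_mul_assoc)
  also have "\<dots> = tr (adj (mpow B (1/2)) ** A ** mpow B (1/2))"
    using tr_mult_commute[of "A ** mpow B (1/2)" "mpow B (1/2)"]
    by (simp add: mpow_hermitian[OF assms(2)] matrix_mul_assoc)
  finally show ?thesis
    using tr_psd_nonneg[OF psd_congruence[OF assms(1), of "mpow B (1/2)"]] by linarith
qed

lemma tr_mult_mono_right:
  assumes "psd A" "psd (C - B)"
  shows "tr (A ** B) \<le> tr (A ** C)"
  using tr_mult_nonneg[OF assms] by (simp add: matrix_diff_ldistrib tr_diff)

text \<open>
  Traces of products of functions of two operators reduce to scalars in the two eigenbases:
  if \<open>w i j\<close> is the squared modulus of the matrix entry of \<open>M\<close> between the eigenvectors
  \<open>i\<close> of \<open>A\<close> and \<open>j\<close> of \<open>B\<close>, every trace is a sum with the same weights.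
\<close>

lemma mpow_overlap:
  fixes A B M :: "'n::finite cmat"
  assumes "psd A" "psd B"
  obtains a b :: "'n \<Rightarrow> real" and w :: "'n \<Rightarrow> 'n \<Rightarrow> real" where
    "\<And>i. 0 \<le> a i" "\<And>j. 0 \<le> b j" "\<And>i j. 0 \<le> w i j"
    "\<And>s t. tr (mpow A s ** M ** mpow B t ** adj M)
      = (\<Sum>i\<in>UNIV. \<Sum>j\<in>UNIV. a i powr s * b j powr t * w i j)"
    "tr (A ** M ** adj M) = (\<Sum>i\<in>UNIV. \<Sum>j\<in>UNIV. a i * w i j)"
    "tr (M ** B ** adj M) = (\<Sum>i\<in>UNIV. \<Sum>j\<in>UNIV. b j * w i j)"
proof -
  obtain U a where U: "unitary U" "A = U ** diagmat a ** adj U" "\<And>i. 0 \<le> a i"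
    using psd_diagonalization[OF assms(1)] by metis
  obtain V b where V: "unitary V" "B = V ** diagmat b ** adj V" "\<And>i. 0 \<le> b i"
    using psd_diagonalization[OF assms(2)] by metis
  define N where "N = adj U ** M ** V"
  define w where "w i j = (cmod (N $ i $ j))\<^sup>2" for i j
  have gen: "tr ((U ** diagmat f ** adj U) ** M ** (V ** diagmat g ** adj V) ** adj M)
      = (\<Sum>i\<in>UNIV. \<Sum>j\<in>UNIV. f i * g j * w i j)" for f g
  proof -
    have "tr ((U ** diagmat f ** adj U) ** M ** (V ** diagmat g ** adj V) ** adj M)
        = tr (U ** (diagmat f ** N ** diagmat g ** adj V ** adj M))"
      by (simp add: N_def matrix_mul_assoc)
    also have "\<dots> = tr ((diagmat f ** N ** diagmat g) ** adj N)"
      by (subst tr_mult_commute) (simp add: N_def matrix_mul_assoc adj_mult)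
    also have "\<dots> = N \<bullet> (diagmat f ** N ** diagmat g)"
      by (subst tr_mult_commute) (simp add: inner_eq_tr)
    also have "\<dots> = (\<Sum>i\<in>UNIV. \<Sum>j\<in>UNIV. f i * g j * w i j)"
    proof -
      have "N $ i $ j \<bullet> (diagmat f ** N ** diagmat g) $ i $ j = f i * g j * w i j" for i j
        unfolding diagmat_mult_left diagmat_mult_right w_def cmod_power2
        by (simp add: inner_complex_def) (simp add: power2_eq_square algebra_simps)
      then show ?thesis by (simp add: inner_vec_def)
    qed
    finally show ?thesis .
  qed
  have "tr (mpow A s ** M ** mpow B t ** adj M)
      = (\<Sum>i\<in>UNIV. \<Sum>j\<in>UNIV. a i powr s * b j powr t * w i j)" for s t
    using gen by (simp add: mpow_eq[OF U(1,2)] mpow_eq[OF V(1,2)])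
  moreover have "tr (A ** M ** adj M) = (\<Sum>i\<in>UNIV. \<Sum>j\<in>UNIV. a i * w i j)"
    using gen[of a "\<lambda>_. 1"] U(2) V(1) by (simp add: unitary_def)
  moreover have "tr (M ** B ** adj M) = (\<Sum>i\<in>UNIV. \<Sum>j\<in>UNIV. b j * w i j)"
    using gen[of "\<lambda>_. 1" b] V(2) U(1) by (simp add: unitary_def)
  ultimately show ?thesis using that[of a b w] U(3) V(3) by (simp add: w_def)
qed

subsection \<open>The pretty good measurement of the square roots\<close>

lemma matrix_mul_zero_left [simp]: "0 ** (N :: 'a::semiring_1^'k^'n) = 0"
  by (simp add: vec_eq_iff matrix_matrix_mult_def)

text \<open>Subtracting the diagonal from a full row sum is the form in which the error bound of the
  measurement arises.\<close>

lemma sum_ordered_pairs: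
  fixes g :: "'k \<Rightarrow> 'k \<Rightarrow> real"
  assumes "finite I"
  shows "(\<Sum>(i, j)\<in>ordered_pairs I. g i j) = (\<Sum>i\<in>I. (\<Sum>j\<in>I. g i j) - g i i)"
proof -
  have "ordered_pairs I = Sigma I (\<lambda>i. I - {i})"
    by (auto simp: ordered_pairs_def)
  then have "(\<Sum>(i, j)\<in>ordered_pairs I. g i j) = (\<Sum>i\<in>I. \<Sum>j\<in>I - {i}. g i j)"
    using assms by (simp add: sum.Sigma)
  also have "\<dots> = (\<Sum>i\<in>I. (\<Sum>j\<in>I. g i j) - g i i)"
    using assms by (intro sum.cong refl) (simp add: sum_diff1)
  finally show ?thesis .
qed

section \<open>Upper and lower bounds on the optimal error\<close>

lemma povm_complement_psd:
  assumes "povm I E" "finite I" "i \<in> I"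
  shows "psd (mat 1 - E i)"
proof -
  have "mat 1 - E i = (mat 1 - (\<Sum>j\<in>I. E j)) + (\<Sum>j\<in>I - {i}. E j)"
    using assms by (simp add: sum_diff1)
  moreover have "psd \<dots>"
    using assms by (intro psd_add psd_sum) (auto simp: povm_def)
  ultimately show ?thesis by (simp only:)
qed

lemma opt_err_le:
  fixes A :: "'k \<Rightarrow> 'n::finite cmat"
  assumes "finite I" "\<And>i. i \<in> I \<Longrightarrow> psd (A i)" "povm I E"
  shows "opt_err I A \<le> (\<Sum>i\<in>I. tr (A i ** (mat 1 - E i)))"
  unfolding opt_err_def
proof (rule cINF_lower)
  \<comment> \<open>The infimum is a lower bound only for a set bounded below; here every error is
    nonnegative.\<close>
  show "bdd_below ((\<lambda>E. \<Sum>i\<in>I. tr (A i ** (mat 1 - E i))) ` {E. povm I E})"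
  proof (rule bdd_belowI2[of _ 0])
    fix F :: "'k \<Rightarrow> 'n cmat"
    assume "F \<in> {E. povm I E}"
    then have "povm I F" by simp
    then show "0 \<le> (\<Sum>i\<in>I. tr (A i ** (mat 1 - F i)))"
      using assms(1,2) by (intro sum_nonneg tr_mult_nonneg povm_complement_psd)
  qed
qed (use assms in simp)

lemma opt_err_greatest:
  assumes "\<And>E. povm I E \<Longrightarrow> m \<le> (\<Sum>i\<in>I. tr (A i ** (mat 1 - E i)))"
  shows "m \<le> opt_err I A"
  unfolding opt_err_def
proof (rule cINF_greatest)
  \<comment> \<open>The effects need only sum to at most the identity, so the zero family is
    admissible.\<close>
  have "povm I (\<lambda>_. 0)" by (simp add: povm_def)
  then show "{E. povm I E} \<noteq> {}" by blast
qed (use assms in simp)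

text \<open>For positive arguments the expression factors as
  \<open>x\<^sup>2 / q * ((x - q)\<^sup>2 * (2 * x + q))\<close>; otherwise all terms vanish,
  including the one with \<open>k powr 0\<close>. The exponents 0 and 1 stay explicit to match the
  summands of \<open>mpow_overlap\<close>.\<close>

lemma sqrt_measurement_scalar_ineq:
  fixes a k :: real
  assumes "0 \<le> a" "0 \<le> k"
  shows "0 \<le> 2 * (a powr (5/4) * k powr (-1/2)) - 3 * (a powr 1 * k powr 0) + a powr (1/2) * k powr 1"
proof (cases "a = 0 \<or> k = 0")
  case False
  with assms have ak: "0 < a" "0 < k" by auto
  define x q where "x = a powr (1/4)" and "q = k powr (1/2)"
  have pos: "0 < x" "0 < q" using ak by (auto simp: x_def q_def)
  have "a powr (5/4) = x ^ 5" "a powr 1 = x ^ 4" "a powr (1/2) = x ^ 2"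
    "k powr (-1/2) = 1 / q" "k powr 1 = q ^ 2"
    using ak by (simp_all add: x_def q_def powr_powr powr_minus_divide flip: powr_numeral powr_realpow)
  then have "2 * (a powr (5/4) * k powr (-1/2)) - 3 * (a powr 1 * k powr 0) + a powr (1/2) * k powr 1
      = x\<^sup>2 / q * ((x - q)\<^sup>2 * (2 * x + q))"
    using ak pos by (simp add: field_simps power2_eq_square eval_nat_numeral)
  moreover have "0 \<le> x\<^sup>2 / q * ((x - q)\<^sup>2 * (2 * x + q))" using pos by simp
  ultimately show ?thesis by linarith
qed (use assms in auto)

text \<open>
  With \<open>c = A\<^sup>1\<^sup>/\<^sup>4\<close> and \<open>T = K\<^sup>-\<^sup>1\<^sup>/\<^sup>2 c\<close>, the success term is \<open>\<parallel>c\<^sup>2 T\<parallel>\<^sup>2\<close>, and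
  \<open>\<parallel>c\<^sup>2 T - c\<^sup>2\<parallel>\<^sup>2 \<ge> 0\<close> bounds it below by an expression in traces \<open>Tr A\<^sup>s K\<^sup>t\<close> only,
  to which the scalar inequality applies termwise.
\<close>

lemma sqrt_measurement_error:
  fixes A K :: "'n::finite cmat"
  assumes A: "psd A" and K: "psd K" and BK: "psd (K - mpow A (1/2))"
  shows "tr (A ** (mat 1 - mpow K (-1/2) ** mpow A (1/2) ** mpow K (-1/2)))
    \<le> tr (mpow A (1/2) ** K) - tr A"
proof -
  define B c Z P where "B = mpow A (1/2)" and "c = mpow A (1/4)"
    and "Z = mpow K (-1/2)" and "P = mat 1 - mpow K 0"
  note herm = mpow_hermitian[OF A] mpow_hermitian[OF K]
  have cc: "c ** c = B" "B ** B = A" "c ** mpow A (3/4) = A" "A ** c = mpow A (5/4)"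
    using mpow_mult[OF A, of 1 "1/4"] A
    by (simp_all add: c_def B_def mpow_mult)
  have ad: "adj B = B" "adj c = c" "adj Z = Z" "adj P = P"
    using herm by (simp_all add: B_def c_def Z_def P_def adj_diff)
  have PP: "P ** P = P"
    using K by (simp add: P_def matrix_diff_ldistrib matrix_diff_rdistrib mpow_mult)
  have psdP: "psd P" using psd_projection(1)[OF ad(4) PP] .
  \<comment> \<open>\<open>P\<close> projects onto the kernel of \<open>K\<close>. The aim is
    \<open>P ** A = 0\<close>, that is, \<open>A\<close> is supported inside the support of
    \<open>K\<close>: from \<open>B \<le> K\<close> the trace of \<open>P ** B\<close>, which is the
    squared norm of \<open>P ** c\<close>, is zero.\<close>
  have "P ** K = mpow K 1 - mpow K 0 ** mpow K 1"
    using K by (simp add: P_def matrix_diff_rdistrib)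
  then have PK: "P ** K = 0" using K by (simp only: mpow_mult) simp
  have "tr (P ** B) \<le> tr (P ** K)"
    by (rule tr_mult_mono_right[OF psdP]) (use BK in \<open>simp add: B_def\<close>)
  moreover have "0 \<le> tr (P ** B)"
    unfolding B_def by (intro tr_mult_nonneg psdP psd_mpow A)
  ultimately have PB: "tr (P ** B) = 0" by (simp add: PK)
  have "(P ** c) \<bullet> (P ** c) = tr (c ** (P ** P ** c))"
    by (simp add: inner_eq_tr adj_mult ad matrix_mul_assoc)
  also have "\<dots> = tr (P ** B)"
    by (subst tr_mult_commute) (simp add: PP cc flip: matrix_mul_assoc)
  finally have "P ** c = 0" using PB by simp
  then have "(P ** c) ** mpow A (3/4) = 0" by simp
  then have "P ** A = 0" using cc(3) by (simp flip: matrix_mul_assoc)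
  then have supp: "tr (A ** mpow K 0) = tr A"
    using tr_mult_commute[of A P] unfolding P_def matrix_diff_ldistrib tr_diff by simp
  define T where "T = Z ** c"
  have "(B ** T - B) \<bullet> (B ** T - B) = (B ** T) \<bullet> (B ** T) - 2 * ((B ** T) \<bullet> B) + B \<bullet> B"
    by (simp add: inner_diff_left inner_diff_right inner_commute[of B "B ** T"])
  then have "0 \<le> (B ** T) \<bullet> (B ** T) - 2 * ((B ** T) \<bullet> B) + B \<bullet> B"
    using inner_ge_zero[of "B ** T - B"] by linarith
  moreover have "(B ** T) \<bullet> (B ** T) = tr (A ** (Z ** B ** Z))"
  proof -
    have "(B ** T) \<bullet> (B ** T) = tr ((c ** Z) ** (B ** B ** Z ** c))"
      by (simp add: inner_eq_tr adj_mult ad T_def matrix_mul_assoc)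
    also have "\<dots> = tr (B ** B ** Z ** (c ** c) ** Z)"
      by (subst tr_mult_commute) (simp add: matrix_mul_assoc)
    finally show ?thesis by (simp add: cc matrix_mul_assoc)
  qed
  moreover have "(B ** T) \<bullet> B = tr (mpow A (5/4) ** Z)"
  proof -
    have "(B ** T) \<bullet> B = tr ((c ** Z) ** (B ** B))"
      by (simp add: inner_eq_tr adj_mult ad T_def matrix_mul_assoc)
    also have "\<dots> = tr (A ** c ** Z)"
      by (subst tr_mult_commute) (simp add: cc(2) matrix_mul_assoc)
    finally show ?thesis by (simp add: cc)
  qed
  moreover have "B \<bullet> B = tr A" by (simp add: inner_eq_tr ad cc)
  ultimately have 1: "0 \<le> tr (A ** (Z ** B ** Z)) - 2 * tr (mpow A (5/4) ** Z) + tr A"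
    by linarith
  obtain a k :: "'n \<Rightarrow> real" and w where nn: "\<And>i. 0 \<le> a i" "\<And>j. 0 \<le> k j" "\<And>i j. 0 \<le> w i j"
    and ov: "\<And>s t. tr (mpow A s ** mat 1 ** mpow K t ** adj (mat 1))
      = (\<Sum>i\<in>UNIV. \<Sum>j\<in>UNIV. a i powr s * k j powr t * w i j)"
    by (rule mpow_overlap[OF A K, of "mat 1"]) blast
  have ov: "tr (mpow A s ** mpow K t) = (\<Sum>i\<in>UNIV. \<Sum>j\<in>UNIV. a i powr s * k j powr t * w i j)" for s t
    using ov[of s t] by simp
  have "0 \<le> (\<Sum>i\<in>UNIV. \<Sum>j\<in>UNIV. (2 * (a i powr (5/4) * k j powr (-1/2))
      - 3 * (a i powr 1 * k j powr 0) + a i powr (1/2) * k j powr 1) * w i j)"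
    using nn by (intro sum_nonneg mult_nonneg_nonneg sqrt_measurement_scalar_ineq)
  also have "\<dots> = 2 * tr (mpow A (5/4) ** mpow K (-1/2)) - 3 * tr (mpow A 1 ** mpow K 0)
      + tr (mpow A (1/2) ** mpow K 1)"
    unfolding ov by (simp add: sum_distrib_left sum.distrib sum_subtractf left_diff_distrib
        distrib_right mult.assoc)
  finally have "0 \<le> 2 * tr (mpow A (5/4) ** Z) - 3 * tr A + tr (B ** K)"
    using A K supp by (simp add: Z_def B_def)
  \<comment> \<open>Adding this inequality to \<open>1\<close> eliminates the mixed term
    \<open>tr (mpow A (5/4) ** Z)\<close>.\<close>
  with 1 show ?thesis
    by (simp add: Z_def B_def matrix_diff_ldistrib tr_diff)
qed

lemma opt_err_le_sum_tr_sqrt: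
  assumes fin: "finite I" and A: "\<And>i. i \<in> I \<Longrightarrow> psd (A i)"
  shows "opt_err I A \<le> (\<Sum>(i, j)\<in>ordered_pairs I. tr (mpow (A i) (1/2) ** mpow (A j) (1/2)))"
proof -
  define B where "B i = mpow (A i) (1/2)" for i
  define K where "K = (\<Sum>i\<in>I. B i)"
  define Z where "Z = mpow K (-1/2)"
  have B: "psd (B i)" if "i \<in> I" for i using that A psd_mpow unfolding B_def by blast
  have K: "psd K" unfolding K_def by (intro psd_sum B)
  have Z: "adj Z = Z" unfolding Z_def by (rule mpow_hermitian[OF K])
  have KB: "psd (K - B i)" if "i \<in> I" for i
  proof -
    have "K - B i = (\<Sum>j\<in>I - {i}. B j)" using that fin by (simp add: K_def sum_diff1)
    then show ?thesis using B by (auto intro: psd_sum)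
  qed
  \<comment> \<open>The effects sum to the support projection of \<open>K\<close>, which is at most
    the identity.\<close>
  have "(\<Sum>i\<in>I. Z ** B i ** Z) = Z ** K ** Z"
    by (simp add: K_def matrix_sum_ldistrib matrix_sum_rdistrib)
  also have "\<dots> = mpow K (-1/2) ** mpow K 1 ** mpow K (-1/2)" using K by (simp add: Z_def)
  also have "\<dots> = mpow K 0" by (simp only: mpow_mult[OF K]) simp
  finally have sum_E: "(\<Sum>i\<in>I. Z ** B i ** Z) = mpow K 0" .
  have "povm I (\<lambda>i. Z ** B i ** Z)"
    unfolding povm_def sum_E
    using B psd_congruence[of _ Z] Z psd_projection(2)[of "mpow K 0"] K
    by (simp add: mpow_hermitian mpow_mult)
  then have "opt_err I A \<le> (\<Sum>i\<in>I. tr (A i ** (mat 1 - Z ** B i ** Z)))"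
    by (intro opt_err_le fin A)
  also have "\<dots> \<le> (\<Sum>i\<in>I. tr (B i ** K) - tr (A i))"
    using sqrt_measurement_error[OF A K] KB by (intro sum_mono) (simp add: Z_def B_def)
  \<comment> \<open>Since \<open>B i ** B i = A i\<close>, the subtracted \<open>tr (A i)\<close> is
    exactly the diagonal term.\<close>
  also have "\<dots> = (\<Sum>i\<in>I. (\<Sum>j\<in>I. tr (B i ** B j)) - tr (B i ** B i))"
    using A by (intro sum.cong refl) (simp add: K_def matrix_sum_ldistrib tr_sum B_def mpow_mult)
  also have "\<dots> = (\<Sum>(i, j)\<in>ordered_pairs I. tr (B i ** B j))"
    by (rule sum_ordered_pairs[OF fin, symmetric])
  finally show ?thesis by (simp add: B_def)
qed

subsection \<open>Trace norm and fidelity\<close>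

text \<open>\<open>W = X ** mpow G (-1/2)\<close> with \<open>G = adj X ** X\<close> is the partial
  isometry of the polar decomposition; \<open>adj W ** W\<close> and \<open>W ** adj W\<close> are
  projections, hence at most the identity.\<close>

lemma trace_norm_polar:
  fixes X :: "'n::finite cmat"
  obtains W where "psd (mat 1 - W ** adj W)" "psd (mat 1 - adj W ** W)"
    "trace_norm X = tr (adj W ** X)"
proof -
  define G where "G = adj X ** X"
  have G: "psd G" by (simp add: G_def psd_gram)
  define W where "W = X ** mpow G (-1/2)"
  have adW: "adj W = mpow G (-1/2) ** adj X" by (simp add: W_def adj_mult mpow_hermitian[OF G])
  have mult: "mpow G s ** G = mpow G (s + 1)" for s
    using mpow_mult[OF G, of s 1] G by simp
  have "adj W ** X = mpow G (-1/2) ** G" by (simp add: adW G_def matrix_mul_assoc)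
  then have "trace_norm X = tr (adj W ** X)"
    by (simp add: trace_norm_def mult flip: G_def)
  moreover have WW: "adj W ** W = mpow G 0"
  proof -
    have "adj W ** W = mpow G (-1/2) ** G ** mpow G (-1/2)"
      by (subst adW) (simp add: W_def G_def matrix_mul_assoc)
    then show ?thesis by (simp add: mult mpow_mult[OF G])
  qed
  then have "psd (mat 1 - adj W ** W)"
    using psd_projection(2)[of "mpow G 0"] by (simp add: mpow_mult[OF G] mpow_hermitian[OF G])
  moreover have "psd (mat 1 - W ** adj W)"
  proof (rule psd_projection(2))
    have "W ** mpow G 0 = W" by (simp add: W_def mpow_mult[OF G] flip: matrix_mul_assoc)
    then show "W ** adj W ** (W ** adj W) = W ** adj W"
      using WW by (metis matrix_mul_assoc)
  qed (simp add: adj_mult)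
  ultimately show ?thesis using that by blast
qed

text \<open>Writing \<open>X = X ** mpow G (-1/4) ** mpow G (1/4)\<close> turns the trace into a
  Hilbert-Schmidt product of two matrices whose norms both equal the square root of the trace
  norm.\<close>

lemma tr_le_trace_norm: "tr X \<le> trace_norm X"
proof -
  define G where "G = adj X ** X"
  have G: "psd G" by (simp add: G_def psd_gram)
  define P where "P = mat 1 - mpow G 0"
  \<comment> \<open>\<open>X\<close> annihilates the kernel of \<open>G\<close>: the squared norm of
    \<open>X ** P\<close> is the trace of \<open>P ** G ** P\<close>.\<close>
  have "G ** P = mpow G 1 - mpow G 1 ** mpow G 0"
    using G by (simp add: P_def matrix_diff_ldistrib)
  then have "G ** P = 0" by (simp only: mpow_mult[OF G]) simp
  then have "(X ** P) \<bullet> (X ** P) = 0"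
    by (simp add: inner_eq_tr adj_mult G_def flip: matrix_mul_assoc)
  then have "X ** mpow G 0 = X" by (simp add: P_def matrix_diff_ldistrib)
  then have "X = X ** (mpow G (-1/4) ** mpow G (1/4))" by (simp add: mpow_mult[OF G])
  then have "tr X = tr (mpow G (1/4) ** (X ** mpow G (-1/4)))"
    by (metis matrix_mul_assoc tr_mult_commute)
  also have "\<dots> = mpow G (1/4) \<bullet> (X ** mpow G (-1/4))"
    by (simp add: inner_eq_tr mpow_hermitian[OF G])
  also have "\<dots> \<le> norm (mpow G (1/4)) * norm (X ** mpow G (-1/4))"
    by (rule norm_cauchy_schwarz)
  also have "norm (mpow G (1/4)) = sqrt (trace_norm X)"
    by (simp add: norm_eq_sqrt_inner inner_eq_tr mpow_hermitian[OF G] mpow_mult[OF G]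
        trace_norm_def flip: G_def)
  also have "norm (X ** mpow G (-1/4)) = sqrt (trace_norm X)"
  proof -
    have "(X ** mpow G (-1/4)) \<bullet> (X ** mpow G (-1/4)) = tr (mpow G (-1/4) ** mpow G 1 ** mpow G (-1/4))"
      by (simp add: inner_eq_tr mpow_hermitian[OF psd_gram] mpow_1[OF psd_gram] adj_mult G_def
          matrix_mul_assoc)
    also have "\<dots> = trace_norm X"
      by (simp only: mpow_mult[OF G]) (simp add: trace_norm_def flip: G_def)
    finally show ?thesis by (simp add: norm_eq_sqrt_inner)
  qed
  also have "sqrt (trace_norm X) * sqrt (trace_norm X) = trace_norm X"
    using tr_psd_nonneg[OF psd_mpow[OF G]] by (simp add: trace_norm_def flip: G_def)
  finally show ?thesis .
qed

lemma trace_norm_nonneg: "0 \<le> trace_norm X"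
  unfolding trace_norm_def by (intro tr_psd_nonneg psd_mpow psd_gram)

lemma trace_norm_scaleR:
  assumes "0 \<le> r"
  shows "trace_norm (r *\<^sub>R X) = r * trace_norm X"
proof -
  have "adj (r *\<^sub>R X) = r *\<^sub>R adj X" by (simp add: vec_eq_iff)
  then have "adj (r *\<^sub>R X) ** (r *\<^sub>R X) = r\<^sup>2 *\<^sub>R (adj X ** X)"
    by (simp add: matrix_scaleR_left matrix_scaleR_right power2_eq_square)
  then show ?thesis
    using assms by (simp add: trace_norm_def mpow_scaleR[OF psd_gram] tr_scaleR powr_half_sqrt)
qed

section \<open>Fidelity and the optimal error of two operators\<close>

lemma fidelity_nonneg: "0 \<le> fidelity A B"
  by (simp add: fidelity_def trace_norm_nonneg)

text \<open>Cauchy-Schwarz after splitting \<open>E\<close> into two square roots;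
  \<open>W ** adj W \<le> I\<close> then removes \<open>W\<close> from the first norm.\<close>

lemma tr_sqrt_sandwich_le:
  assumes A: "psd A" and B: "psd B" and E: "psd E" and W: "psd (mat 1 - W ** adj W)"
  shows "tr (adj W ** mpow A (1/2) ** E ** mpow B (1/2)) \<le> sqrt (tr (A ** E)) * sqrt (tr (B ** E))"
proof -
  define a b e where "a = mpow A (1/2)" and "b = mpow B (1/2)" and "e = mpow E (1/2)"
  have ad: "adj a = a" "adj b = b" "adj e = e"
    by (simp_all add: a_def b_def e_def mpow_hermitian A B E)
  have sq: "a ** a = A" "b ** b = B" "e ** e = E"
    using A B E by (simp_all add: a_def b_def e_def mpow_mult)
  have sq': "M ** e ** e = M ** E" "M ** b ** b = M ** B" "M ** a ** a = M ** A" for M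
    by (simp_all add: sq flip: matrix_mul_assoc)
  have "tr (adj W ** a ** E ** b) = (e ** a ** W) \<bullet> (e ** b)"
    by (simp add: inner_eq_tr adj_mult ad matrix_mul_assoc sq')
  also have "\<dots> \<le> norm (e ** a ** W) * norm (e ** b)"
    by (rule norm_cauchy_schwarz)
  also have "norm (e ** b) = sqrt (tr (B ** E))"
  proof -
    have "(e ** b) \<bullet> (e ** b) = tr (b ** (E ** b))"
      by (simp add: inner_eq_tr adj_mult ad matrix_mul_assoc sq')
    also have "\<dots> = tr (B ** E)"
      by (subst tr_mult_commute) (simp add: matrix_mul_assoc sq' tr_mult_commute[of E])
    finally show ?thesis by (simp add: norm_eq_sqrt_inner)
  qed
  also have "norm (e ** a ** W) \<le> sqrt (tr (A ** E))"
  proof -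
    have "(e ** a ** W) \<bullet> (e ** a ** W) = tr (adj W ** (a ** E ** a ** W))"
      by (simp add: inner_eq_tr adj_mult ad matrix_mul_assoc sq')
    also have "\<dots> = tr (a ** E ** a ** (W ** adj W))"
      by (subst tr_mult_commute) (simp add: matrix_mul_assoc)
    also have "\<dots> \<le> tr (a ** E ** a ** mat 1)"
      using psd_congruence[OF E, of a] W by (intro tr_mult_mono_right) (simp_all add: ad)
    also have "\<dots> = tr (a ** (E ** a))" by (simp add: matrix_mul_assoc)
    also have "\<dots> = tr (A ** E)"
      by (subst tr_mult_commute) (simp add: matrix_mul_assoc sq' tr_mult_commute[of E])
    finally show ?thesis by (simp add: norm_eq_sqrt_inner)
  qed
  finally show ?thesis
    unfolding a_def b_def using tr_mult_nonneg[OF B E] by (simp add: mult_right_mono)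
qed

text \<open>\<open>E\<close> is the outcome in favour of \<open>A\<close>, so the last factor is the
  total error of the test. Inserting \<open>I = E + F\<close> leaves one error term in each of the
  two summands.\<close>

lemma fidelity_sq_le_test:
  assumes A: "psd A" and B: "psd B" and E: "psd E" and F: "psd (mat 1 - E)"
  shows "(fidelity A B)\<^sup>2 \<le> (tr A + tr B) * (tr (A ** (mat 1 - E)) + tr (B ** E))"
proof -
  define F where "F = mat 1 - E"
  have F: "psd F" using F by (simp add: F_def)
  obtain W where W: "psd (mat 1 - W ** adj W)"
    "fidelity A B = tr (adj W ** (mpow A (1/2) ** mpow B (1/2)))"
    unfolding fidelity_def by (rule trace_norm_polar)
  define u v x y where "u = sqrt (tr A)" and "v = sqrt (tr B)"
    and "x = sqrt (tr (B ** E))" and "y = sqrt (tr (A ** F))"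
  note nn = tr_psd_nonneg[OF A] tr_psd_nonneg[OF B] tr_mult_nonneg[OF B E] tr_mult_nonneg[OF A F]
  have uvxy: "u\<^sup>2 = tr A" "v\<^sup>2 = tr B" "x\<^sup>2 = tr (B ** E)" "y\<^sup>2 = tr (A ** F)"
    "0 \<le> u" "0 \<le> v" "0 \<le> x" "0 \<le> y"
    using nn by (simp_all add: u_def v_def x_def y_def)
  have "fidelity A B = tr (adj W ** mpow A (1/2) ** E ** mpow B (1/2))
      + tr (adj W ** mpow A (1/2) ** F ** mpow B (1/2))"
    by (simp add: W(2) F_def matrix_diff_ldistrib matrix_diff_rdistrib tr_diff matrix_mul_assoc)
  also have "\<dots> \<le> sqrt (tr (A ** E)) * x + y * sqrt (tr (B ** F))"
    using tr_sqrt_sandwich_le[OF A B E W(1)] tr_sqrt_sandwich_le[OF A B F W(1)]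
    by (simp add: x_def y_def)
  \<comment> \<open>Only the factors that are not errors are enlarged to full traces.\<close>
  also have "\<dots> \<le> u * x + y * v"
  proof -
    have "tr (A ** E) \<le> tr A" "tr (B ** F) \<le> tr B"
      using tr_mult_mono_right[OF A, of "mat 1" E] tr_mult_mono_right[OF B, of "mat 1" F] E F
      by (simp_all add: F_def)
    then show ?thesis using uvxy nn tr_mult_nonneg[OF B F]
      by (intro add_mono mult_mono) (auto simp: u_def v_def)
  qed
  finally have "(fidelity A B)\<^sup>2 \<le> (u * x + y * v)\<^sup>2"
    using fidelity_nonneg by (intro power_mono) auto
  also have "\<dots> \<le> (u\<^sup>2 + v\<^sup>2) * (y\<^sup>2 + x\<^sup>2)"
  proof -
    \<comment> \<open>Lagrange's identity, giving Cauchy-Schwarz in the plane.\<close>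
    have "(u\<^sup>2 + v\<^sup>2) * (y\<^sup>2 + x\<^sup>2) - (u * x + y * v)\<^sup>2 = (u * y - v * x)\<^sup>2"
      by (simp add: power2_eq_square algebra_simps)
    then show ?thesis by (metis diff_ge_0_iff_ge zero_le_power2)
  qed
  finally show ?thesis by (simp add: uvxy F_def)
qed

text \<open>For any POVM the effect \<open>E i\<close> serves as the test, and
  \<open>E i \<le> I - E j\<close> bounds its error on \<open>A j\<close>. Dividing by the sum of
  the traces makes the left side a constant lower bound for the infimum.\<close>

lemma fidelity_sq_le_opt_err:
  fixes A :: "'k \<Rightarrow> 'n::finite cmat"
  assumes "i \<noteq> j" and A: "psd (A i)" "psd (A j)" and pos: "0 < tr (A i) + tr (A j)"
  shows "(fidelity (A i) (A j))\<^sup>2 \<le> (tr (A i) + tr (A j)) * opt_err {i, j} A"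
proof -
  have "(fidelity (A i) (A j))\<^sup>2 / (tr (A i) + tr (A j)) \<le> opt_err {i, j} A"
  proof (rule opt_err_greatest)
    fix E :: "'k \<Rightarrow> 'n cmat"
    assume E: "povm {i, j} E"
    have sum_E: "(\<Sum>k\<in>{i, j}. E k) = E i + E j" using \<open>i \<noteq> j\<close> by simp
    have "psd ((mat 1 - E j) - E i)"
      using E unfolding povm_def sum_E by (simp add: algebra_simps)
    then have "tr (A j ** E i) \<le> tr (A j ** (mat 1 - E j))"
      by (rule tr_mult_mono_right[OF A(2)])
    moreover have "(fidelity (A i) (A j))\<^sup>2
        \<le> (tr (A i) + tr (A j)) * (tr (A i ** (mat 1 - E i)) + tr (A j ** E i))"
      using E povm_complement_psd[OF E] A by (intro fidelity_sq_le_test) (auto simp: povm_def)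
    then have "(fidelity (A i) (A j))\<^sup>2 / (tr (A i) + tr (A j))
        \<le> tr (A i ** (mat 1 - E i)) + tr (A j ** E i)"
      using pos by (simp add: pos_divide_le_eq mult.commute)
    ultimately show "(fidelity (A i) (A j))\<^sup>2 / (tr (A i) + tr (A j))
        \<le> (\<Sum>k\<in>{i, j}. tr (A k ** (mat 1 - E k)))"
      using \<open>i \<noteq> j\<close> by simp
  qed
  then show ?thesis using pos by (simp add: pos_divide_le_eq mult.commute)
qed

section \<open>Fidelity and \<open>Q_min\<close>\<close>

lemma weighted_am_gm:
  fixes a b s :: real
  assumes "0 \<le> a" "0 \<le> b" "0 \<le> s" "s \<le> 1"
  shows "a powr s * b powr (1 - s) \<le> s * a + (1 - s) * b"
\<comment> \<open>If an argument is zero, the left side is zero even for exponent 0, by the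
  convention \<open>0 powr 0 = 0\<close>.\<close>
proof (cases "a = 0 \<or> b = 0")
  case False
  then show ?thesis using assms Youngs_inequality_0[of s "1 - s" a b] by simp
qed (use assms in auto)

text \<open>The fidelity is the Hilbert-Schmidt product of \<open>V\<close> and \<open>Y\<close>.
  The squared norm of \<open>Y\<close> is the right-hand side, and that of \<open>V\<close> is at
  most 1.\<close>

lemma fidelity_sq_le_tr_mpow:
  fixes S T :: "'n::finite cmat"
  assumes S: "psd S" and T: "psd T" and tr1: "tr S = 1" "tr T = 1" and s: "0 \<le> s" "s \<le> 1"
  shows "(fidelity S T)\<^sup>2 \<le> tr (mpow S s ** mpow T (1 - s))"
proof -
  obtain W where W: "psd (mat 1 - W ** adj W)" "psd (mat 1 - adj W ** W)"
    "fidelity S T = tr (adj W ** (mpow S (1/2) ** mpow T (1/2)))"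
    unfolding fidelity_def by (rule trace_norm_polar)
  define V Y where "V = mpow S ((1-s)/2) ** W ** mpow T (s/2)"
    and "Y = mpow S (s/2) ** mpow T ((1-s)/2)"
  have comb: "M ** mpow S x ** mpow S y = M ** mpow S (x + y)"
    "M ** mpow T x ** mpow T y = M ** mpow T (x + y)" for M x y
    by (simp_all add: mpow_mult S T flip: matrix_mul_assoc)
  have half: "(1 - s) / 2 + s / 2 = 1 / 2" "s / 2 + (1 - s) / 2 = 1 / 2"
    by (simp_all add: field_simps)
  have "V \<bullet> Y = tr (mpow T (s/2) ** (adj W ** mpow S (1/2) ** mpow T ((1-s)/2)))"
    by (simp add: inner_eq_tr V_def Y_def adj_mult mpow_hermitian S T matrix_mul_assoc comb half)
  also have "\<dots> = fidelity S T"
    by (subst tr_mult_commute) (simp add: W(3) matrix_mul_assoc comb half)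
  finally have "fidelity S T \<le> norm V * norm Y" by (metis norm_cauchy_schwarz)
  then have "(fidelity S T)\<^sup>2 \<le> (norm V * norm Y)\<^sup>2"
    using fidelity_nonneg by (intro power_mono)
  also have "\<dots> = (V \<bullet> V) * (Y \<bullet> Y)"
    by (simp add: power_mult_distrib power2_norm_eq_inner)
  also have "Y \<bullet> Y = tr (mpow S s ** mpow T (1 - s))"
  proof -
    have "Y \<bullet> Y = tr (mpow T ((1-s)/2) ** (mpow S s ** mpow T ((1-s)/2)))"
      by (simp add: inner_eq_tr Y_def adj_mult mpow_hermitian S T matrix_mul_assoc comb)
    then show ?thesis
      by (subst (asm) tr_mult_commute) (simp add: comb)
  qed
  also have "(V \<bullet> V) * tr (mpow S s ** mpow T (1 - s)) \<le> 1 * tr (mpow S s ** mpow T (1 - s))"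
  proof (rule mult_right_mono)
    show "0 \<le> tr (mpow S s ** mpow T (1 - s))" by (intro tr_mult_nonneg psd_mpow S T)
    obtain a b :: "'n \<Rightarrow> real" and w where nn: "\<And>i. 0 \<le> a i" "\<And>j. 0 \<le> b j" "\<And>i j. 0 \<le> w i j"
      and ov: "\<And>s t. tr (mpow S s ** W ** mpow T t ** adj W)
        = (\<Sum>i\<in>UNIV. \<Sum>j\<in>UNIV. a i powr s * b j powr t * w i j)"
      "tr (S ** W ** adj W) = (\<Sum>i\<in>UNIV. \<Sum>j\<in>UNIV. a i * w i j)"
      "tr (W ** T ** adj W) = (\<Sum>i\<in>UNIV. \<Sum>j\<in>UNIV. b j * w i j)"
      by (rule mpow_overlap[OF S T, of W]) blast
    have "V \<bullet> V = tr (mpow T (s/2) ** (adj W ** mpow S (1 - s) ** W ** mpow T (s/2)))"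
      by (simp add: inner_eq_tr V_def adj_mult mpow_hermitian S T matrix_mul_assoc comb)
    also have "\<dots> = tr (adj W ** (mpow S (1 - s) ** W ** mpow T s))"
      by (subst tr_mult_commute) (simp add: comb matrix_mul_assoc)
    also have "\<dots> = tr (mpow S (1 - s) ** W ** mpow T s ** adj W)"
      by (rule tr_mult_commute)
    \<comment> \<open>The weighted AM-GM inequality is applied to each pair of eigenvalues, with
      nonnegative weights \<open>w i j\<close>.\<close>
    also have "\<dots> \<le> (\<Sum>i\<in>UNIV. \<Sum>j\<in>UNIV. ((1 - s) * a i + s * b j) * w i j)"
      unfolding ov using nn s weighted_am_gm[of "b _" "a _" s]
      by (intro sum_mono mult_right_mono) (simp_all add: algebra_simps)
    also have "\<dots> = (1 - s) * tr (S ** (W ** adj W)) + s * tr (W ** T ** adj W)"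
      using ov(2,3) by (simp add: matrix_mul_assoc sum_distrib_left sum.distrib distrib_right mult.assoc)
    also have "tr (W ** T ** adj W) = tr (T ** (adj W ** W))"
      using tr_mult_commute[of W "T ** adj W"] by (simp add: matrix_mul_assoc)
    \<comment> \<open>Both \<open>W ** adj W\<close> and \<open>adj W ** W\<close> are at most the
      identity, and the states have trace one.\<close>
    also have "(1 - s) * tr (S ** (W ** adj W)) + s * tr (T ** (adj W ** W))
        \<le> (1 - s) * 1 + s * 1"
      using tr_mult_mono_right[OF S W(1)] tr_mult_mono_right[OF T W(2)] tr1 s
      by (intro add_mono mult_left_mono) simp_all
    finally show "V \<bullet> V \<le> 1" by simp
  qed
  finally show ?thesis by simp
qed

lemma fidelity_sq_le_Q_min:
  assumes "psd S" "psd T" "tr S = 1" "tr T = 1"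
  shows "(fidelity S T)\<^sup>2 \<le> Q_min S T"
  unfolding Q_min_def using assms by (intro cINF_greatest fidelity_sq_le_tr_mpow) auto

subsection \<open>Pure states\<close>

lemma tr_pos:
  assumes A: "psd A" and "A \<noteq> 0"
  shows "0 < tr A"
proof -
  have eq: "mpow A (1/2) \<bullet> mpow A (1/2) = tr A"
    using A by (simp add: inner_eq_tr mpow_hermitian mpow_mult)
  have "mpow A (1/2) \<noteq> 0"
  proof
    assume "mpow A (1/2) = 0"
    then show False using mpow_mult[OF A, of "1/2" "1/2"] A \<open>A \<noteq> 0\<close> by simp
  qed
  then show ?thesis using eq inner_gt_zero_iff[of "mpow A (1/2)"] by simp
qed

lemma fidelity_scaleR:
  assumes "psd S" "psd T" "0 \<le> p" "0 \<le> q"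
  shows "fidelity (p *\<^sub>R S) (q *\<^sub>R T) = sqrt (p * q) * fidelity S T"
proof -
  have "mpow (p *\<^sub>R S) (1/2) ** mpow (q *\<^sub>R T) (1/2)
      = sqrt (p * q) *\<^sub>R (mpow S (1/2) ** mpow T (1/2))"
    using assms by (simp add: mpow_scaleR powr_half_sqrt matrix_scaleR_left matrix_scaleR_right
        real_sqrt_mult)
  then show ?thesis using assms by (simp add: fidelity_def trace_norm_scaleR)
qed

text \<open>A projection of rank one, given in diagonal form so that \<open>mpow_eq\<close> yields
  its powers at once.\<close>

definition pure_state :: "'n::finite cmat \<Rightarrow> bool" where
  "pure_state S \<longleftrightarrow> (\<exists>U k. unitary U \<and> S = U ** diagmat (\<lambda>i. if i = k then 1 else 0) ** adj U)"

text \<open>The row space is spanned by a single vector \<open>v\<close>, and \<open>c i\<close> is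
  the coefficient of row \<open>i\<close>.\<close>

lemma rank_1_entries:
  fixes M :: "'a::field^'n^'m"
  assumes "rank M = 1"
  obtains c x where "\<And>i j. M $ i $ j = c i * x j"
proof -
  obtain B where B: "rows M \<subseteq> vec.span B" "card B = vec.dim (rows M)"
    using vec.basis_exists[of "rows M"] by metis
  then obtain v where v: "B = {v}"
    using assms by (auto simp: row_rank_def_gen card_1_singleton_iff)
  have "\<exists>c. M $ i = c *s v" for i
  proof -
    have "M $ i \<in> rows M" by (auto simp: rows_def row_def)
    then have "M $ i \<in> vec.span {v}" using B v by blast
    then show ?thesis by (auto simp: vec.span_singleton)
  qed
  then obtain c where "\<And>i. M $ i = c i *s v" by metis
  then have "M $ i $ j = c i * (v $ j)" for i j by simp
  then show ?thesis by (rule that)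
qed

text \<open>The outer product form of the entries survives the passage to an eigenbasis. A diagonal
  matrix of this form has at most one nonzero entry, which is 1 by the trace condition.\<close>

lemma pure_state_if_rank_1:
  fixes S :: "'n::finite cmat"
  assumes S: "psd S" and tr1: "tr S = 1" and rank: "rank S = 1"
  shows "pure_state S"
proof -
  obtain U d where U: "unitary U" "S = U ** diagmat d ** adj U" "\<And>i. 0 \<le> d i"
    using psd_diagonalization[OF S] by metis
  obtain c x where cx: "\<And>i j. S $ i $ j = c i * x j"
    using rank_1_entries[OF rank] by metis
  have D: "diagmat d = adj U ** S ** U"
  proof -
    have "adj U ** S ** U = (adj U ** U) ** diagmat d ** (adj U ** U)"
      unfolding U(2) by (simp add: matrix_mul_assoc)
    then show ?thesis using U(1) by (simp add: unitary_def)
  qed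
  define c' x' where "c' i = (\<Sum>k\<in>UNIV. adj U $ i $ k * c k)"
    and "x' j = (\<Sum>k\<in>UNIV. x k * U $ k $ j)" for i j
  have D': "diagmat d $ i $ j = c' i * x' j" for i j
  proof -
    have "(adj U ** S) $ i $ k = c' i * x k" for k
      unfolding matrix_matrix_mult_def c'_def by (simp add: cx sum_distrib_right mult.assoc)
    then show ?thesis
      unfolding D by (simp add: matrix_matrix_mult_def[of "adj U ** S"] x'_def sum_distrib_left mult.assoc)
  qed
  \<comment> \<open>The vanishing entry \<open>c' i * x' j\<close> has a zero factor, which also
    divides \<open>d i\<close> or \<open>d j\<close>.\<close>
  have single: "d i = 0 \<or> d j = 0" if "i \<noteq> j" for i j
    using D'[of i j] D'[of i i] D'[of j j] that by (auto simp: diagmat_def)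
  have "tr S = tr (adj U ** (U ** diagmat d))"
    unfolding U(2) by (rule tr_mult_commute)
  also have "\<dots> = tr (diagmat d)"
    using U(1) by (simp add: matrix_mul_assoc unitary_def)
  finally have sum_d: "(\<Sum>i\<in>UNIV. d i) = 1"
    using tr1 by (simp add: tr_def trace_def diagmat_def)
  then obtain k where "d k \<noteq> 0" by (metis sum.neutral zero_neq_one)
  then have d0: "d i = 0" if "i \<noteq> k" for i using single that by blast
  then have "(\<Sum>i\<in>UNIV. d i) = d k" by (simp add: sum.remove[of UNIV k])
  then have "d = (\<lambda>i. if i = k then 1 else 0)" using sum_d d0 by auto
  then show ?thesis unfolding pure_state_def using U(1,2) by blast
qed

lemma mpow_pure_state:
  assumes "pure_state S"
  shows "mpow S s = S"
proof -
  obtain U k where U: "unitary U" "S = U ** diagmat (\<lambda>i. if i = k then 1 else 0) ** adj U"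
    using assms unfolding pure_state_def by blast
  have "(\<lambda>i. (if i = k then 1 else 0) powr s) = (\<lambda>i. if i = k then 1 else 0 :: real)" by auto
  then show ?thesis using mpow_eq[OF U, of s] by (simp only: U(2)[symmetric])
qed

text \<open>In the eigenbasis of \<open>S\<close> only the diagonal entry \<open>N $ k $ k\<close>
  survives; it is real because \<open>N\<close> is hermitian, and it equals the trace of
  \<open>M ** S\<close>.\<close>

lemma pure_state_sandwich:
  fixes S M :: "'n::finite cmat"
  assumes S: "pure_state S" and M: "psd M"
  shows "S ** M ** S = tr (M ** S) *\<^sub>R S"
proof -
  obtain U k where U: "unitary U" "S = U ** diagmat (\<lambda>i. if i = k then 1 else 0) ** adj U"
    using S unfolding pure_state_def by blast
  define D N where "D = (diagmat (\<lambda>i. if i = k then 1 else 0) :: 'n cmat)" and "N = adj U ** M ** U"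
  have "adj N = N" unfolding N_def using psd_congruence[OF M] by (rule psd_hermitian)
  then have "cnj (N $ k $ k) = N $ k $ k" by (metis adj_component)
  then have real: "N $ k $ k = complex_of_real (Re (N $ k $ k))" by (simp add: complex_eq_iff)
  have entry: "(D ** N ** D) $ i $ j = (if i = k \<and> j = k then N $ k $ k else 0)" for i j
    unfolding D_def diagmat_mult_left diagmat_mult_right by simp
  have "D ** N ** D = Re (N $ k $ k) *\<^sub>R D"
    using real by (simp add: vec_eq_iff entry) (simp add: D_def diagmat_def scaleR_conv_of_real)
  moreover have "S ** M ** S = U ** (D ** N ** D) ** adj U"
    by (simp add: U(2) D_def N_def matrix_mul_assoc)
  ultimately have sand: "S ** M ** S = Re (N $ k $ k) *\<^sub>R S"
    by (simp add: U(2) D_def matrix_scaleR_left matrix_scaleR_right)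
  have "tr (M ** S) = tr ((M ** U ** D) ** adj U)"
    by (simp add: U(2) D_def matrix_mul_assoc)
  also have "\<dots> = tr (N ** D)"
    by (subst tr_mult_commute) (simp add: N_def matrix_mul_assoc)
  also have "\<dots> = Re (N $ k $ k)"
    unfolding tr_def trace_def D_def diagmat_mult_right by (simp add: if_distrib[of "\<lambda>x. _ * x"] cong: if_cong)
  finally show ?thesis using sand by simp
qed

text \<open>Both states are their own square roots, and \<open>T ** S ** T\<close> is a multiple of
  \<open>T\<close>, so the square root in the trace norm is explicit.\<close>

lemma fidelity_pure_state_sq:
  assumes S: "psd S" "pure_state S" and T: "psd T" "pure_state T" and tr1: "tr T = 1"
  shows "(fidelity S T)\<^sup>2 = tr (S ** T)"
proof -
  have SS: "S ** S = S"
    using mpow_mult[OF S(1), of 0 0] by (simp add: mpow_pure_state S)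
  have "adj (S ** T) ** (S ** T) = T ** (S ** S) ** T"
    by (simp add: adj_mult psd_hermitian S T matrix_mul_assoc)
  also have "\<dots> = tr (S ** T) *\<^sub>R T"
    by (simp add: SS pure_state_sandwich[OF T(2) S(1)])
  finally have "trace_norm (S ** T) = sqrt (tr (S ** T))"
    using tr_mult_nonneg[OF S(1) T(1)] T tr1
    by (simp add: trace_norm_def mpow_scaleR mpow_pure_state tr_scaleR powr_half_sqrt)
  then show ?thesis
    using tr_mult_nonneg[OF S(1) T(1)] S T by (simp add: fidelity_def mpow_pure_state)
qed

text \<open>The infimum is over a function constant in \<open>s\<close>.\<close>

lemma Q_min_pure_state: "pure_state S \<Longrightarrow> pure_state T \<Longrightarrow> Q_min S T = tr (S ** T)"
  by (simp add: Q_min_def mpow_pure_state)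

theorem theorem3p5:
  fixes A \<sigma> :: "nat \<Rightarrow> 'n::finite cmat" and p :: "nat \<Rightarrow> real" and r :: nat
  assumes "1 \<le> r"
    and "\<And>k. k \<in> {1..r} \<Longrightarrow> psd (A k)"
    and "\<And>k. k \<in> {1..r} \<Longrightarrow> A k \<noteq> 0"
    and "\<And>k. k \<in> {1..r} \<Longrightarrow> p k = tr (A k)"
    and "\<And>k. k \<in> {1..r} \<Longrightarrow> \<sigma> k = (1 / tr (A k)) *\<^sub>R A k"
  shows
    "(opt_err {1..r} A
       \<le> (\<Sum>(i,j)\<in>ordered_pairs {1..r}. tr (mpow (A i) (1/2) ** mpow (A j) (1/2))))
   \<and> ((\<Sum>(i,j)\<in>ordered_pairs {1..r}. tr (mpow (A i) (1/2) ** mpow (A j) (1/2)))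
       \<le> (\<Sum>(i,j)\<in>ordered_pairs {1..r}. fidelity (A i) (A j)))
   \<and> ((\<Sum>(i,j)\<in>ordered_pairs {1..r}. fidelity (A i) (A j))
       \<le> (\<Sum>(i,j)\<in>ordered_pairs {1..r}. sqrt (p i + p j) * sqrt (opt_err {i,j} A)))
   \<and> ((\<Sum>(i,j)\<in>ordered_pairs {1..r}. fidelity (A i) (A j))
       \<le> (\<Sum>(i,j)\<in>ordered_pairs {1..r}. sqrt (p i * p j) * sqrt (Q_min (\<sigma> i) (\<sigma> j))))
   \<and> ((\<forall>k\<in>{1..r}. rank (\<sigma> k) = 1) \<longrightarrow>
       opt_err {1..r} A
         \<le> (\<Sum>(i,j)\<in>ordered_pairs {1..r}. tr (mpow (A i) (1/2) ** mpow (A j) (1/2)))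
     \<and> (\<Sum>(i,j)\<in>ordered_pairs {1..r}. tr (mpow (A i) (1/2) ** mpow (A j) (1/2)))
         = (\<Sum>(i,j)\<in>ordered_pairs {1..r}. sqrt (p i * p j) * Q_min (\<sigma> i) (\<sigma> j))
     \<and> (\<Sum>(i,j)\<in>ordered_pairs {1..r}. sqrt (p i * p j) * Q_min (\<sigma> i) (\<sigma> j))
         = (\<Sum>(i,j)\<in>ordered_pairs {1..r}. 1 / sqrt (p i * p j) * (fidelity (A i) (A j))\<^sup>2)
     \<and> (\<Sum>(i,j)\<in>ordered_pairs {1..r}. 1 / sqrt (p i * p j) * (fidelity (A i) (A j))\<^sup>2)
         \<le> (\<Sum>(i,j)\<in>ordered_pairs {1..r}. (p i + p j) / sqrt (p i * p j) * opt_err {i,j} A))"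
proof -
  let ?I = "{1..r}"
  have psd_A: "psd (A k)" if "k \<in> ?I" for k using assms(2) that .
  have p_pos: "0 < p k" if "k \<in> ?I" for k
    using tr_pos[OF assms(2) assms(3)] assms(4) that by simp
  have A_eq: "A k = p k *\<^sub>R \<sigma> k" if "k \<in> ?I" for k
    using assms(4,5)[OF that] p_pos[OF that] by simp
  have psd_\<sigma>: "psd (\<sigma> k)" if "k \<in> ?I" for k
    using assms(4,5)[OF that] p_pos[OF that] psd_A[OF that] by (simp add: psd_scaleR)
  have tr_\<sigma>: "tr (\<sigma> k) = 1" if "k \<in> ?I" for k
    using assms(4,5)[OF that] p_pos[OF that] by (simp add: tr_scaleR)
  have fid: "fidelity (A i) (A j) = sqrt (p i * p j) * fidelity (\<sigma> i) (\<sigma> j)"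
    if "i \<in> ?I" "j \<in> ?I" for i j
    using that p_pos[of i] p_pos[of j] by (simp add: A_eq fidelity_scaleR psd_\<sigma>)
  have fid_err: "(fidelity (A i) (A j))\<^sup>2 \<le> (p i + p j) * opt_err {i, j} A"
    if "i \<in> ?I" "j \<in> ?I" "i \<noteq> j" for i j
    using fidelity_sq_le_opt_err[OF that(3), of A] psd_A that p_pos[of i] p_pos[of j] assms(4)[of i]
      assms(4)[of j] by simp
  have 1: "opt_err ?I A
      \<le> (\<Sum>(i,j)\<in>ordered_pairs ?I. tr (mpow (A i) (1/2) ** mpow (A j) (1/2)))"
    by (intro opt_err_le_sum_tr_sqrt psd_A) auto
  have 2: "(\<Sum>(i,j)\<in>ordered_pairs ?I. tr (mpow (A i) (1/2) ** mpow (A j) (1/2)))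
      \<le> (\<Sum>(i,j)\<in>ordered_pairs ?I. fidelity (A i) (A j))"
    unfolding fidelity_def by (intro sum_mono) (auto intro: tr_le_trace_norm)
  have 3: "(\<Sum>(i,j)\<in>ordered_pairs ?I. fidelity (A i) (A j))
      \<le> (\<Sum>(i,j)\<in>ordered_pairs ?I. sqrt (p i + p j) * sqrt (opt_err {i,j} A))"
  proof (intro sum_mono, clarify)
    fix i j assume "(i, j) \<in> ordered_pairs ?I"
    then have "(fidelity (A i) (A j))\<^sup>2 \<le> (p i + p j) * opt_err {i, j} A"
      using fid_err unfolding ordered_pairs_def by blast
    from real_le_rsqrt[OF this]
    show "fidelity (A i) (A j) \<le> sqrt (p i + p j) * sqrt (opt_err {i, j} A)"
      by (simp add: real_sqrt_mult)
  qed
  have 4: "(\<Sum>(i,j)\<in>ordered_pairs ?I. fidelity (A i) (A j))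
      \<le> (\<Sum>(i,j)\<in>ordered_pairs ?I. sqrt (p i * p j) * sqrt (Q_min (\<sigma> i) (\<sigma> j)))"
  proof (intro sum_mono, clarify)
    fix i j assume "(i, j) \<in> ordered_pairs ?I"
    then have ij: "i \<in> ?I" "j \<in> ?I" by (auto simp: ordered_pairs_def)
    have "fidelity (\<sigma> i) (\<sigma> j) \<le> sqrt (Q_min (\<sigma> i) (\<sigma> j))"
      by (intro real_le_rsqrt fidelity_sq_le_Q_min psd_\<sigma> tr_\<sigma> ij)
    then show "fidelity (A i) (A j) \<le> sqrt (p i * p j) * sqrt (Q_min (\<sigma> i) (\<sigma> j))"
      using p_pos[OF ij(1)] p_pos[OF ij(2)] by (simp add: fid[OF ij] mult_left_mono)
  qed
  \<comment> \<open>With \<open>q = sqrt (p i * p j)\<close> and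
    \<open>t = tr (\<sigma> i ** \<sigma> j)\<close>, the first two expressions are
    \<open>q * t\<close> and the squared fidelity is \<open>q\<^sup>2 * t\<close>. The final
    inequality is \<open>fid_err\<close> divided by \<open>q\<close>.\<close>
  have pure_case: "tr (mpow (A i) (1/2) ** mpow (A j) (1/2)) = sqrt (p i * p j) * Q_min (\<sigma> i) (\<sigma> j)
      \<and> sqrt (p i * p j) * Q_min (\<sigma> i) (\<sigma> j) = 1 / sqrt (p i * p j) * (fidelity (A i) (A j))\<^sup>2
      \<and> 1 / sqrt (p i * p j) * (fidelity (A i) (A j))\<^sup>2
        \<le> (p i + p j) / sqrt (p i * p j) * opt_err {i,j} A"
    if rank: "\<forall>k\<in>?I. rank (\<sigma> k) = 1" and "(i, j) \<in> ordered_pairs ?I" for i j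
  proof -
    have ij: "i \<in> ?I" "j \<in> ?I" "i \<noteq> j" using that(2) by (auto simp: ordered_pairs_def)
    have pure: "pure_state (\<sigma> i)" "pure_state (\<sigma> j)"
      by (intro pure_state_if_rank_1 psd_\<sigma> tr_\<sigma> ij bspec[OF rank])+
    note pos = p_pos[OF ij(1)] p_pos[OF ij(2)]
    have "tr (mpow (A i) (1/2) ** mpow (A j) (1/2)) = sqrt (p i * p j) * tr (\<sigma> i ** \<sigma> j)"
      using pos ij by (simp add: A_eq mpow_scaleR psd_\<sigma> mpow_pure_state pure powr_half_sqrt
          matrix_scaleR_left matrix_scaleR_right tr_scaleR real_sqrt_mult)
    moreover have "(fidelity (A i) (A j))\<^sup>2 = sqrt (p i * p j) * (sqrt (p i * p j) * tr (\<sigma> i ** \<sigma> j))"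
      using pos by (simp add: fid[OF ij(1,2)] power_mult_distrib
          fidelity_pure_state_sq[OF psd_\<sigma>[OF ij(1)] pure(1) psd_\<sigma>[OF ij(2)] pure(2) tr_\<sigma>[OF ij(2)]])
    moreover have "0 < sqrt (p i * p j)" using pos by simp
    moreover have "1 / sqrt (p i * p j) * (fidelity (A i) (A j))\<^sup>2
        \<le> (p i + p j) / sqrt (p i * p j) * opt_err {i,j} A"
      using divide_right_mono[OF fid_err[OF ij], of "sqrt (p i * p j)"] pos by simp
    ultimately show ?thesis by (simp add: Q_min_pure_state pure)
  qed
  show ?thesis
    using 1 2 3 4 pure_case by (auto intro!: sum.cong sum_mono)
qed

end
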